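(* Let $n \in \mathbb{N}^*$, let $a_j<b_j$ be real numbers for $j=1,\dots,n$, let $g_j(\mathbf{x}) = (x_j-a_j)(x_j-b_j)$, and let $\mathcal{H} = \prod_{j=1}^n \{a_j,b_j\} \subset \mathbb{R}^n$. Let $d \in \mathbb{N}$ and let $f \in \mathbb{R}[x_1,\dots,x_n]$ be a polynomial of degree at most $2d+2$ that vanishes on $\mathcal{H}$. Then there exist $s_1,\dots,s_{2n} \in C_{n,2d}$ such that $$f = \sum_{j=1}^n s_j g_j + \sum_{j=1}^n s_{n+j}(-g_j).$$
   Context: $\mathbb{N}$ contains $0$ and $\mathbb{N}^* = \mathbb{N}\setminus\{0\}$. A circuit polynomial is a polynomial $f(\mathbf{x}) = \sum_{j=0}^r f_{\boldsymbol{\alpha}(j)} \mathbf{x}^{\boldsymbol{\alpha}(j)} + f_{\boldsymbol{\beta}} \mathbf{x}^{\boldsymbol{\beta}}$ in $\mathbb{R}[x_1,\dots,x_n]$ with $0\le r \le n$, exponents $\boldsymbol{\alpha}(j),\boldsymbol{\beta} \in \mathbb{N}^n$, $f_{\boldsymbol{\alpha}(j)} > 0$, $f_{\boldsymbol{\beta}} \in \mathbb{R}$, such that $\boldsymbol{\alpha}(0),\dots,\boldsymbol{\alpha}(r)$ lie in $(2\mathbb{N})^n$ and are affinely independent (so they are the vertices of a simplex), and $\boldsymbol{\beta}$ lies in the relative interior of that simplex. In particular, monomial squares $c\,\mathbf{x}^{\boldsymbol{\alpha}}$ with $c>0$ and $\boldsymbol{\alpha} \in (2\mathbb{N})^n$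 count as (nonnegative) circuit polynomials. A circuit polynomial is nonnegative if it is nonnegative on all of $\mathbb{R}^n$. $C_{n,2d}$ is the set of SONC polynomials (sums of nonnegative circuit polynomials) in $n$ variables of degree at most $2d$: all $f=\sum_{i=1}^k \mu_i q_i$ of degree at most $2d$ with $k\in\mathbb{N}^*$, $\mu_i \ge 0$ and $q_i$ nonnegative circuit polynomials. (For $d=0$ these are the nonnegative constants.) *)

theory Defs
  imports "HOL-Analysis.Analysis" "HOL-Library.Poly_Mapping"
begin

text \<open>
  The \<open>n\<close> variables are indexed by a finite type \<open>'n\<close>, so \<open>n = CARD('n) \<ge> 1\<close>. Exponents are vectors
  in \<open>nat ^ 'n\<close>, and a polynomial is the finitely supported family of its coefficients;
  the ring structure (convolution product) is that of \<open>HOL-Library.Poly_Mapping\<close>.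
\<close>

type_synonym 'n exponent = "nat ^ 'n"

type_synonym 'n mpoly = "(nat ^ 'n) \<Rightarrow>\<^sub>0 real"

definition monomial :: "real \<Rightarrow> 'n::finite exponent \<Rightarrow> 'n mpoly" where
  "monomial c \<alpha> = Poly_Mapping.single \<alpha> c"

definition Const :: "real \<Rightarrow> 'n::finite mpoly" where
  "Const c = monomial c 0"

definition Var :: "'n::finite \<Rightarrow> 'n mpoly" where
  "Var j = monomial 1 (axis j 1)"

definition eval :: "'n::finite mpoly \<Rightarrow> real ^ 'n \<Rightarrow> real" where
  "eval p x = (\<Sum>\<alpha>\<in>Poly_Mapping.keys p. Poly_Mapping.lookup p \<alpha> * (\<Prod>i\<in>UNIV. (x $ i) ^ (\<alpha> $ i)))"

text \<open>Total degree; the zero polynomial gets degree \<open>0\<close>, so it satisfies every degree bound.\<close>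

definition total_degree :: "'n::finite mpoly \<Rightarrow> nat" where
  "total_degree p = Max (insert 0 ((\<lambda>\<alpha>. \<Sum>i\<in>UNIV. \<alpha> $ i) ` Poly_Mapping.keys p))"

definition real_exponent :: "'n::finite exponent \<Rightarrow> real ^ 'n" where
  "real_exponent \<alpha> = (\<chi> i. real (\<alpha> $ i))"

text \<open>
  \<open>affine_dependent\<close> is a predicate on sets, so injectivity of \<open>\<alpha>\<close> is needed to express affine
  independence of the family \<open>\<alpha> 0, \<dots>, \<alpha> r\<close>. For \<open>r = 0\<close> the simplex is a point, so \<open>\<beta> = \<alpha> 0\<close>.
\<close>

definition circuit_polynomial :: "'n::finite mpoly \<Rightarrow> bool" where
  "circuit_polynomial f \<longleftrightarrow>
    (\<exists>(r::nat) (\<alpha> :: nat \<Rightarrow> 'n exponent) (\<beta> :: 'n exponent) (c :: nat \<Rightarrow> real) (c\<^sub>\<beta> :: real).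
       r \<le> CARD('n) \<and>
       (\<forall>j\<le>r. c j > 0) \<and>
       (\<forall>j\<le>r. \<forall>i. even (\<alpha> j $ i)) \<and>
       inj_on \<alpha> {..r} \<and>
       \<not> affine_dependent ((\<lambda>j. real_exponent (\<alpha> j)) ` {..r}) \<and>
       real_exponent \<beta> \<in> rel_interior (convex hull ((\<lambda>j. real_exponent (\<alpha> j)) ` {..r})) \<and>
       f = (\<Sum>j\<le>r. monomial (c j) (\<alpha> j)) + monomial c\<^sub>\<beta> \<beta>)"

definition nonneg_circuit_polynomial :: "'n::finite mpoly \<Rightarrow> bool" where
  "nonneg_circuit_polynomial f \<longleftrightarrow> circuit_polynomial f \<and> (\<forall>x. eval f x \<ge> 0)"

text \<open>\<open>SONC D\<close> is \<open>C\<^bsub>n,D\<^esub>\<close>, with \<open>n\<close> given by the index type; it is used with \<open>D = 2d\<close>.\<close>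

definition SONC :: "nat \<Rightarrow> 'n::finite mpoly set" where
  "SONC D = {f. total_degree f \<le> D \<and>
     (\<exists>(k::nat) (\<mu> :: nat \<Rightarrow> real) (q :: nat \<Rightarrow> 'n mpoly).
        k \<ge> 1 \<and>
        (\<forall>i\<in>{1..k}. \<mu> i \<ge> 0 \<and> nonneg_circuit_polynomial (q i)) \<and>
        f = (\<Sum>i=1..k. Const (\<mu> i) * q i))}"

definition box_constraint :: "real ^ 'n \<Rightarrow> real ^ 'n \<Rightarrow> 'n::finite \<Rightarrow> 'n mpoly" where
  "box_constraint a b j = (Var j - Const (a $ j)) * (Var j - Const (b $ j))"

definition hypercube :: "real ^ 'n \<Rightarrow> real ^ 'n::finite \<Rightarrow> (real ^ 'n) set" where
  "hypercube a b = {x. \<forall>j. x $ j \<in> {a $ j, b $ j}}"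

end

theory Submission
  imports Defs
begin

text \<open>
  Modulo the ideal generated by the \<open>g\<^sub>j\<close>, the relation
  \<open>x\<^sub>j\<^sup>2 \<equiv> (a\<^sub>j + b\<^sub>j) x\<^sub>j - a\<^sub>j b\<^sub>j\<close> reduces \<open>f\<close> to a multilinear polynomial, with cofactors of degree
  at most \<open>2d\<close>. The remainder vanishes on the grid, and interpolation in each variable recovers its
  coefficients from its values there, so it is zero. It remains to write each cofactor as a
  difference of SONC polynomials. A monomial of degree at most \<open>2d\<close> is \<open>x\<^sup>u x\<^sup>v\<close> with \<open>u\<close>, \<open>v\<close> of
  weight at most \<open>d\<close>, and \<open>2 x\<^sup>u x\<^sup>v = (x\<^sup>u + x\<^sup>v)\<^sup>2 - x\<^bsup>2u\<^esup> - x\<^bsup>2v\<^esup>\<close>; for \<open>u \<noteq> v\<close> this square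
  is a circuit polynomial supported on a segment and its midpoint.
\<close>

section \<open>Exponent vectors and their monomial values\<close>

definition weight :: "'n::finite exponent \<Rightarrow> nat" where
  "weight \<alpha> = (\<Sum>i\<in>UNIV. \<alpha> $ i)"

definition power_vec :: "real ^ 'n::finite \<Rightarrow> 'n exponent \<Rightarrow> real" where
  "power_vec x \<alpha> = (\<Prod>i\<in>UNIV. (x $ i) ^ (\<alpha> $ i))"

lemma weight_0 [simp]: "weight 0 = 0"
  by (simp add: weight_def)

lemma weight_add [simp]: "weight (\<alpha> + \<beta>) = weight \<alpha> + weight \<beta>"
  by (simp add: weight_def sum.distrib)

lemma weight_axis [simp]: "weight (axis i k) = k"
  by (simp add: weight_def axis_def)

lemma power_vec_0 [simp]: "power_vec x 0 = 1"
  by (simp add: power_vec_def)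

lemma power_vec_add: "power_vec x (\<alpha> + \<beta>) = power_vec x \<alpha> * power_vec x \<beta>"
  by (simp add: power_vec_def prod.distrib power_add)

lemma power_vec_axis [simp]: "power_vec x (axis i k) = (x $ i) ^ k"
proof -
  have "power_vec x (axis i k) = (\<Prod>j\<in>UNIV. if j = i then (x $ i) ^ k else 1)"
    unfolding power_vec_def by (rule prod.cong) (auto simp: axis_def)
  then show ?thesis by simp
qed

lemma exponent_split_axis:
  fixes \<gamma> :: "'n::finite exponent"
  assumes "k \<le> \<gamma> $ i"
  obtains \<delta> where "\<gamma> = \<delta> + axis i k"
proof
  \<comment> \<open>The subtraction is on naturals; the assumption on \<open>\<gamma> $ i\<close>
    keeps it from truncating.\<close>
  show "\<gamma> = (\<chi> j. \<gamma> $ j - axis i k $ j) + axis i k"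
    using assms by (auto simp: vec_eq_iff axis_def)
qed

text \<open>Greedy: as long as the weight exceeds \<open>p + q\<close>, some variable still occurs
  and one factor of it can be moved into \<open>u\<close>. With \<open>p = q = d\<close> this cuts a
  monomial into two halves whose squares stay within degree \<open>2 * d\<close>.\<close>

lemma exponent_split_weight:
  fixes \<gamma> :: "'n::finite exponent"
  assumes "weight \<gamma> \<le> p + q"
  shows "\<exists>u v. \<gamma> = u + v \<and> weight u \<le> p \<and> weight v \<le> q"
  using assms
proof (induction p arbitrary: \<gamma>)
  case 0
  then show ?case by (intro exI[of _ 0] exI[of _ \<gamma>]) simp
next
  case (Suc p)
  show ?case
  proof (cases "weight \<gamma> \<le> p + q")
    case True
    then show ?thesis using Suc.IH le_SucI by blast
  next
    case False
    then have "weight \<gamma> \<noteq> 0" by simp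
    then obtain i where "\<gamma> $ i \<noteq> 0" by (auto simp: weight_def)
    then have "1 \<le> \<gamma> $ i" by simp
    then obtain \<delta> where \<delta>: "\<gamma> = \<delta> + axis i 1" by (rule exponent_split_axis)
    with Suc.prems have "weight \<delta> \<le> p + q" by simp
    then obtain u v where uv: "\<delta> = u + v" "weight u \<le> p" "weight v \<le> q"
      using Suc.IH by blast
    then show ?thesis
      by (intro exI[of _ "u + axis i 1"] exI[of _ v]) (simp add: \<delta> ac_simps)
  qed
qed

section \<open>Monomials, degree bounds and evaluation\<close>

lemma mult_monomial: "monomial c \<alpha> * monomial e \<beta> = monomial (c * e) (\<alpha> + \<beta>)"
  by (simp add: monomial_def mult_single)

lemma monomial_add: "monomial (c + e) \<alpha> = monomial c \<alpha> + monomial e \<alpha>"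
  by (simp add: monomial_def single_add)

lemma monomial_diff: "monomial (c - e) \<alpha> = monomial c \<alpha> - monomial e \<alpha>"
  by (simp add: monomial_def single_diff)

lemma monomial_0 [simp]: "monomial 0 \<alpha> = 0"
  by (simp add: monomial_def)

lemma Const_1 [simp]: "Const 1 = 1"
  by (simp add: Const_def monomial_def)

lemma Const_0 [simp]: "Const 0 = 0"
  by (simp add: Const_def)

lemma sum_monomials: "p = (\<Sum>\<gamma>\<in>Poly_Mapping.keys p. monomial (Poly_Mapping.lookup p \<gamma>) \<gamma>)"
  by (rule poly_mapping_eqI)
     (auto simp: monomial_def lookup_sum lookup_single when_def in_keys_iff)

lemma total_degree_le_iff:
  "total_degree p \<le> D \<longleftrightarrow> (\<forall>\<gamma>\<in>Poly_Mapping.keys p. weight \<gamma> \<le> D)"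
  by (simp add: total_degree_def weight_def)

lemma total_degree_monomial_le: "weight \<gamma> \<le> D \<Longrightarrow> total_degree (monomial c \<gamma>) \<le> D"
  by (simp add: total_degree_le_iff monomial_def)

lemma total_degree_0 [simp]: "total_degree 0 = 0"
  by (simp add: total_degree_def)

lemma total_degree_add_le:
  "total_degree p \<le> D \<Longrightarrow> total_degree q \<le> D \<Longrightarrow> total_degree (p + q) \<le> D"
  unfolding total_degree_le_iff using keys_add[of p q] by blast

text \<open>Zero coefficients contribute nothing. A common index set for several polynomials avoids
  tracking cancellation in the support of their sum.\<close>

lemma eval_superset:
  assumes "finite A" "Poly_Mapping.keys p \<subseteq> A"
  shows "eval p x = (\<Sum>\<alpha>\<in>A. Poly_Mapping.lookup p \<alpha> * power_vec x \<alpha>)"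
  unfolding eval_def power_vec_def[symmetric]
  by (rule sum.mono_neutral_left) (use assms in \<open>auto simp: in_keys_iff\<close>)

lemma eval_0 [simp]: "eval 0 x = 0"
  by (simp add: eval_def)

lemma eval_monomial [simp]: "eval (monomial c \<alpha>) x = c * power_vec x \<alpha>"
  by (subst eval_superset[of "{\<alpha>}"]) (auto simp: monomial_def)

lemma eval_add [simp]: "eval (p + q) x = eval p x + eval q x"
proof -
  let ?A = "Poly_Mapping.keys p \<union> Poly_Mapping.keys q"
  have "Poly_Mapping.keys (p + q) \<subseteq> ?A" by (rule keys_add)
  then show ?thesis
    by (simp add: eval_superset[of ?A] lookup_add sum.distrib algebra_simps)
qed

lemma eval_sum: "eval (\<Sum>i\<in>A. p i) x = (\<Sum>i\<in>A. eval (p i) x)"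
  by (induction A rule: infinite_finite_induct) auto

lemma eval_mult [simp]: "eval (p * q) x = eval p x * eval q x"
proof -
  have "eval (p * q) x =
    eval ((\<Sum>\<gamma>\<in>Poly_Mapping.keys p. monomial (Poly_Mapping.lookup p \<gamma>) \<gamma>) *
          (\<Sum>\<gamma>\<in>Poly_Mapping.keys q. monomial (Poly_Mapping.lookup q \<gamma>) \<gamma>)) x"
    by (simp flip: sum_monomials)
  also have "\<dots> =
    eval (\<Sum>\<gamma>\<in>Poly_Mapping.keys p. monomial (Poly_Mapping.lookup p \<gamma>) \<gamma>) x *
    eval (\<Sum>\<gamma>\<in>Poly_Mapping.keys q. monomial (Poly_Mapping.lookup q \<gamma>) \<gamma>) x"
    by (simp add: sum_product eval_sum mult_monomial power_vec_add ac_simps)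
  finally show ?thesis by (simp flip: sum_monomials)
qed

lemma box_constraint_eq:
  "box_constraint a b j =
     monomial 1 (axis j 2) - monomial (a $ j + b $ j) (axis j 1) + monomial (a $ j * b $ j) 0"
proof -
  have "axis j (1::nat) + axis j 1 = axis j 2"
    by (simp add: vec_eq_iff axis_def)
  then show ?thesis
    by (simp add: box_constraint_def Var_def Const_def algebra_simps mult_monomial monomial_add)
qed

lemma eval_box_constraint: "eval (box_constraint a b j) x = (x $ j - a $ j) * (x $ j - b $ j)"
proof -
  \<comment> \<open>Turns the differences into sums of monomials, which \<open>eval\<close> handles
    termwise.\<close>
  have "- monomial c \<alpha> = monomial (- c) \<alpha>" for c and \<alpha> :: "'a exponent"
    using monomial_diff[of 0 c \<alpha>] by simp
  then show ?thesis
    unfolding box_constraint_eq diff_conv_add_uminus by (simp add: algebra_simps power2_eq_square)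
qed

subsection \<open>Differences of SONC polynomials\<close>

text \<open>Here \<open>r = 0\<close>: the simplex is the point \<open>u + u\<close>, which is its
  own relative interior, so \<open>\<beta>\<close> is that point with coefficient 0.\<close>

lemma circuit_polynomial_monomial_square:
  assumes "c > 0"
  shows "circuit_polynomial (monomial c (u + u))"
  unfolding circuit_polynomial_def
  using assms
  by (intro exI[of _ "0::nat"] exI[of _ "\<lambda>_. u + u"] exI[of _ "u + u"] exI[of _ "\<lambda>_. c"]
        exI[of _ "0::real"])
     auto

text \<open>Here \<open>r = 1\<close>: doubled exponents are even, and \<open>u + v\<close> is the
  midpoint of the segment between them, hence in its relative interior because the endpoints
  differ.\<close>

lemma circuit_polynomial_binomial_square:
  fixes u v :: "'n::finite exponent"
  assumes "k > 0" "u \<noteq> v"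
  shows "circuit_polynomial (monomial k (u + u) + monomial k (v + v) + monomial c (u + v))"
proof -
  define \<alpha> where "\<alpha> j = (if j = 0 then u + u else v + v)" for j :: nat
  obtain i where i: "u $ i \<noteq> v $ i"
    using assms(2) by (auto simp: vec_eq_iff)
  then have "(u + u) $ i \<noteq> (v + v) $ i" by simp
  then have neq: "u + u \<noteq> v + v" by metis
  have set2: "{..1} = {0, 1::nat}" by auto
  have im: "(\<lambda>j. real_exponent (\<alpha> j)) ` {..1} = {real_exponent (u + u), real_exponent (v + v)}"
    unfolding set2 by (simp add: \<alpha>_def)
  have rneq: "real_exponent (u + u) \<noteq> real_exponent (v + v)"
  proof
    assume "real_exponent (u + u) = real_exponent (v + v)"
    then have "real_exponent (u + u) $ i = real_exponent (v + v) $ i" by simp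
    with i show False by (simp add: real_exponent_def)
  qed
  have mid: "real_exponent (u + v) = midpoint (real_exponent (u + u)) (real_exponent (v + v))"
    by (simp add: vec_eq_iff real_exponent_def midpoint_def)
  have "real_exponent (u + v) \<in>
      rel_interior (convex hull {real_exponent (u + u), real_exponent (v + v)})"
    unfolding mid segment_convex_hull[symmetric] rel_interior_closed_segment
    using rneq by simp
  moreover have "inj_on \<alpha> {..1}"
    unfolding set2 using neq by (simp add: \<alpha>_def)
  moreover have "(\<Sum>j\<le>1. monomial k (\<alpha> j)) = monomial k (u + u) + monomial k (v + v)"
    unfolding set2 by (simp add: \<alpha>_def)
  moreover have "1 \<le> CARD('n)"
    by (simp add: Suc_le_eq)
  moreover have "\<forall>j\<le>1. \<forall>i. even (\<alpha> j $ i)"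
    by (simp add: \<alpha>_def)
  ultimately show ?thesis
    unfolding circuit_polynomial_def
    using assms(1)
    by (intro exI[of _ "1::nat"] exI[of _ \<alpha>] exI[of _ "u + v"] exI[of _ "\<lambda>_. k"] exI[of _ c])
       (simp add: im del: One_nat_def)
qed

lemma nonneg_circuit_polynomial_monomial_square:
  "c > 0 \<Longrightarrow> nonneg_circuit_polynomial (monomial c (u + u))"
  by (simp add: nonneg_circuit_polynomial_def circuit_polynomial_monomial_square power_vec_add)

lemma nonneg_circuit_polynomial_binomial_square:
  assumes "k > 0" "u \<noteq> v" "\<bar>c\<bar> = 2 * k"
  shows "nonneg_circuit_polynomial (monomial k (u + u) + monomial k (v + v) + monomial c (u + v))"
  unfolding nonneg_circuit_polynomial_def
proof (intro conjI allI)
  show "circuit_polynomial (monomial k (u + u) + monomial k (v + v) + monomial c (u + v))"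
    using assms by (simp add: circuit_polynomial_binomial_square)
  fix x
  let ?U = "power_vec x u" and ?V = "power_vec x v"
  \<comment> \<open>Since \<open>\<bar>c\<bar> = 2 * k > 0\<close>, \<open>sgn c\<close> is 1 or -1,
    and the cross term \<open>2 * k * sgn c\<close> equals \<open>c\<close>.\<close>
  have "0 \<le> k * (?U + sgn c * ?V)\<^sup>2"
    using assms(1) by simp
  also have "\<dots> = eval (monomial k (u + u) + monomial k (v + v) + monomial c (u + v)) x"
  proof (cases "c > 0")
    case True
    then show ?thesis using assms by (simp add: power_vec_add power2_eq_square algebra_simps)
  next
    case False
    then have "c = - 2 * k" "sgn c = -1" using assms by auto
    then show ?thesis by (simp add: power_vec_add power2_eq_square algebra_simps)
  qed
  finally show "0 \<le> eval (monomial k (u + u) + monomial k (v + v) + monomial c (u + v)) x" .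
qed

lemma nonneg_circuit_in_SONC:
  assumes "nonneg_circuit_polynomial q" "total_degree q \<le> D"
  shows "q \<in> SONC D"
  unfolding SONC_def mem_Collect_eq
  using assms
  by (intro conjI exI[of _ "1::nat"] exI[of _ "\<lambda>_. 1::real"] exI[of _ "\<lambda>_. q"]) auto

text \<open>At least one summand is required, so the circuit polynomial 1 is taken with multiplier
  0.\<close>

lemma zero_in_SONC: "0 \<in> SONC D"
  unfolding SONC_def mem_Collect_eq
  using nonneg_circuit_polynomial_monomial_square[of 1 0]
  by (intro conjI exI[of _ "1::nat"] exI[of _ "\<lambda>_. 0::real"] exI[of _ "\<lambda>_. monomial 1 0"]) auto

lemma add_in_SONC:
  fixes p q :: "'n::finite mpoly"
  assumes "p \<in> SONC D" "q \<in> SONC D"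
  shows "p + q \<in> SONC D"
proof -
  obtain k :: nat and \<mu> and P :: "nat \<Rightarrow> 'n mpoly" where P: "k \<ge> 1" "\<forall>i\<in>{1..k}. \<mu> i \<ge> 0 \<and> nonneg_circuit_polynomial (P i)"
      "p = (\<Sum>i=1..k. Const (\<mu> i) * P i)"
    using assms(1) unfolding SONC_def by blast
  obtain l :: nat and \<nu> and Q :: "nat \<Rightarrow> 'n mpoly" where Q: "l \<ge> 1" "\<forall>i\<in>{1..l}. \<nu> i \<ge> 0 \<and> nonneg_circuit_polynomial (Q i)"
      "q = (\<Sum>i=1..l. Const (\<nu> i) * Q i)"
    using assms(2) unfolding SONC_def by blast
  \<comment> \<open>Concatenation of the two families: the second one is shifted to the indices from
    \<open>k + 1\<close> to \<open>k + l\<close>.\<close>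
  define \<mu>' where "\<mu>' i = (if i \<le> k then \<mu> i else \<nu> (i - k))" for i
  define R where "R i = (if i \<le> k then P i else Q (i - k))" for i
  have "(\<Sum>i=1..k+l. Const (\<mu>' i) * R i) =
      (\<Sum>i=1..k. Const (\<mu>' i) * R i) + (\<Sum>i=1+k..l+k. Const (\<mu>' i) * R i)"
    by (subst sum.ub_add_nat) (auto simp: ac_simps)
  also have "\<dots> = p + q"
    unfolding sum.shift_bounds_cl_nat_ivl P(3) Q(3)
    by (intro arg_cong2[where f = "(+)"] sum.cong) (auto simp: \<mu>'_def R_def)
  finally have eq: "p + q = (\<Sum>i=1..k+l. Const (\<mu>' i) * R i)" ..
  have nonneg: "\<forall>i\<in>{1..k+l}. \<mu>' i \<ge> 0 \<and> nonneg_circuit_polynomial (R i)"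
  proof
    fix i assume i: "i \<in> {1..k+l}"
    show "\<mu>' i \<ge> 0 \<and> nonneg_circuit_polynomial (R i)"
    proof (cases "i \<le> k")
      case True
      with i P(2) show ?thesis by (simp add: \<mu>'_def R_def)
    next
      case False
      with i have "i - k \<in> {1..l}" by auto
      with False Q(2) show ?thesis by (simp add: \<mu>'_def R_def)
    qed
  qed
  have "total_degree (p + q) \<le> D"
    using assms by (auto simp: SONC_def intro: total_degree_add_le)
  moreover have "1 \<le> k + l" using P(1) by simp
  ultimately show ?thesis
    unfolding SONC_def mem_Collect_eq using eq nonneg by blast
qed

lemma monomial_square_in_SONC:
  assumes "c \<ge> 0" "2 * weight u \<le> D"
  shows "monomial c (u + u) \<in> SONC D"
proof (cases "c = 0")
  case True
  then show ?thesis by (simp add: zero_in_SONC)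
next
  case False
  with assms show ?thesis
    by (intro nonneg_circuit_in_SONC nonneg_circuit_polynomial_monomial_square
        total_degree_monomial_le) auto
qed

lemma monomial_SONC_difference:
  fixes \<gamma> :: "'n::finite exponent"
  assumes "weight \<gamma> \<le> 2 * d"
  shows "\<exists>s\<in>SONC (2 * d). \<exists>t\<in>SONC (2 * d). monomial c \<gamma> = s - t"
proof -
  from assms obtain u v where \<gamma>: "\<gamma> = u + v" and uv: "weight u \<le> d" "weight v \<le> d"
    using exponent_split_weight[of \<gamma> d d] by auto
  \<comment> \<open>For \<open>u = v\<close> the segment degenerates to a point, but then the
    monomial is itself a square up to sign.\<close>
  consider "u = v" "c \<ge> 0" | "u = v" "c < 0" | "c = 0" | "u \<noteq> v" "c \<noteq> 0" by linarith
  then show ?thesis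
  proof cases
    case 1
    then show ?thesis
      using uv by (intro bexI[of _ "monomial c \<gamma>"] bexI[of _ 0])
        (auto simp: \<gamma> intro: monomial_square_in_SONC zero_in_SONC)
  next
    case 2
    have "monomial c \<gamma> = 0 - monomial (- c) \<gamma>"
      using monomial_diff[of 0 "- c" \<gamma>] by simp
    then show ?thesis
      using uv 2 by (intro bexI[of _ 0] bexI[of _ "monomial (- c) \<gamma>"])
        (auto simp: \<gamma> intro: monomial_square_in_SONC zero_in_SONC)
  next
    case 3
    then show ?thesis by (intro bexI[of _ 0]) (auto simp: zero_in_SONC)
  next
    case 4
    \<comment> \<open>This scaling makes the mixed term of the binomial square exactly
      \<open>c\<close> times the monomial; subtracting the two pure squares \<open>?t\<close> leaves
      that term.\<close>
    define k where "k = \<bar>c\<bar> / 2"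
    have k: "k > 0" "\<bar>c\<bar> = 2 * k" using 4 by (auto simp: k_def)
    let ?t = "monomial k (u + u) + monomial k (v + v)"
    have "?t + monomial c (u + v) \<in> SONC (2 * d)"
      using k 4 uv
      by (intro nonneg_circuit_in_SONC nonneg_circuit_polynomial_binomial_square
          total_degree_add_le total_degree_monomial_le) auto
    moreover have "?t \<in> SONC (2 * d)"
      using k uv by (intro add_in_SONC monomial_square_in_SONC) auto
    ultimately show ?thesis
      by (intro bexI[of _ "?t + monomial c (u + v)"] bexI[of _ ?t]) (auto simp: \<gamma>)
  qed
qed

lemma SONC_difference:
  fixes p :: "'n::finite mpoly"
  assumes "total_degree p \<le> 2 * d"
  shows "\<exists>s\<in>SONC (2 * d). \<exists>t\<in>SONC (2 * d). p = s - t"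
proof -
  let ?P = "\<lambda>p :: 'n mpoly. \<exists>s\<in>SONC (2 * d). \<exists>t\<in>SONC (2 * d). p = s - t"
  have add: "?P (p + q)" if "?P p" "?P q" for p q
  proof -
    from that obtain s t s' t' where
      "s \<in> SONC (2 * d)" "t \<in> SONC (2 * d)" "p = s - t"
      "s' \<in> SONC (2 * d)" "t' \<in> SONC (2 * d)" "q = s' - t'" by blast
    then show ?thesis
      by (intro bexI[of _ "s + s'"] bexI[of _ "t + t'"]) (auto intro: add_in_SONC)
  qed
  have zero: "?P 0"
    using zero_in_SONC by force
  \<comment> \<open>The index set \<open>A\<close> varies while \<open>p\<close> stays fixed as the
    source of coefficients, so the induction never changes the polynomial.\<close>
  have "?P (\<Sum>\<gamma>\<in>A. monomial (Poly_Mapping.lookup p \<gamma>) \<gamma>)"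
    if "finite A" "\<forall>\<gamma>\<in>A. weight \<gamma> \<le> 2 * d" for A
    using that
  proof (induction A rule: finite_induct)
    case empty
    then show ?case using zero by simp
  next
    case (insert \<gamma> A)
    then have "?P (monomial (Poly_Mapping.lookup p \<gamma>) \<gamma>)"
      by (intro monomial_SONC_difference) simp
    moreover have "?P (\<Sum>\<gamma>\<in>A. monomial (Poly_Mapping.lookup p \<gamma>) \<gamma>)"
      using insert by simp
    ultimately show ?case
      unfolding sum.insert[OF insert.hyps(1,2)] by (rule add)
  qed
  from this[of "Poly_Mapping.keys p"] show ?thesis
    using assms by (simp add: total_degree_le_iff flip: sum_monomials)
qed

subsection \<open>Reduction modulo the box constraints\<close>

definition multilinear :: "'n::finite mpoly \<Rightarrow> bool" where
  "multilinear r \<longleftrightarrow> (\<forall>\<gamma>\<in>Poly_Mapping.keys r. \<forall>i. \<gamma> $ i \<le> 1)"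

text \<open>\<open>D\<close> bounds the cofactors only: with \<open>D = 2 * d\<close> they are then
  in reach of \<open>SONC_difference\<close>.\<close>

definition reducible :: "real ^ 'n \<Rightarrow> real ^ 'n \<Rightarrow> nat \<Rightarrow> 'n::finite mpoly \<Rightarrow> bool" where
  "reducible a b D f \<longleftrightarrow> (\<exists>p r. (\<forall>j. total_degree (p j) \<le> D) \<and> multilinear r \<and>
     f = (\<Sum>j\<in>UNIV. p j * box_constraint a b j) + r)"

lemma reducible_multilinear: "multilinear r \<Longrightarrow> reducible a b D r"
  unfolding reducible_def by (intro exI[of _ "\<lambda>_. 0"] exI[of _ r]) auto

lemma reducible_add:
  assumes "reducible a b D f" "reducible a b D g"
  shows "reducible a b D (f + g)"
proof -
  obtain p r where p: "\<forall>j. total_degree (p j) \<le> D" "multilinear r"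
      "f = (\<Sum>j\<in>UNIV. p j * box_constraint a b j) + r"
    using assms(1) unfolding reducible_def by blast
  obtain q s where q: "\<forall>j. total_degree (q j) \<le> D" "multilinear s"
      "g = (\<Sum>j\<in>UNIV. q j * box_constraint a b j) + s"
    using assms(2) unfolding reducible_def by blast
  have "multilinear (r + s)"
    using p(2) q(2) keys_add[of r s] unfolding multilinear_def by blast
  moreover have "f + g = (\<Sum>j\<in>UNIV. (p j + q j) * box_constraint a b j) + (r + s)"
    unfolding p(3) q(3) by (simp add: distrib_right sum.distrib)
  ultimately show ?thesis
    unfolding reducible_def using p(1) q(1)
    by (intro exI[of _ "\<lambda>j. p j + q j"] exI[of _ "r + s"]) (auto intro: total_degree_add_le)
qed

lemma reducible_mult_box_constraint:
  assumes "total_degree p \<le> D"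
  shows "reducible a b D (p * box_constraint a b j)"
  unfolding reducible_def
proof (intro exI[of _ "\<lambda>i. if i = j then p else 0"] exI[of _ 0] conjI allI)
  have "(\<Sum>i\<in>UNIV. (if i = j then p else 0) * box_constraint a b i) =
      (\<Sum>i\<in>UNIV. if i = j then p * box_constraint a b j else 0)"
    by (rule sum.cong) auto
  then show "p * box_constraint a b j =
      (\<Sum>i\<in>UNIV. (if i = j then p else 0) * box_constraint a b i) + 0" by simp
qed (use assms in \<open>auto simp: multilinear_def\<close>)

text \<open>Induction on the weight. Replacing a factor \<open>x_j^2\<close> by
  \<open>g_j + (a_j + b_j) x_j - a_j b_j\<close> leaves monomials of weight smaller by 1 and 2, and
  the cofactor of \<open>g_j\<close> has weight two less than \<open>\<gamma>\<close>, hence at most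
  \<open>D\<close>.\<close>

lemma reducible_monomial:
  fixes \<gamma> :: "'n::finite exponent"
  assumes "weight \<gamma> \<le> D + 2"
  shows "reducible a b D (monomial c \<gamma>)"
  using assms
proof (induction "weight \<gamma>" arbitrary: \<gamma> c rule: less_induct)
  case less
  show ?case
  proof (cases "\<forall>i. \<gamma> $ i \<le> 1")
    case True
    then show ?thesis
      by (intro reducible_multilinear) (auto simp: multilinear_def monomial_def split: if_splits)
  next
    case False
    then obtain j where "2 \<le> \<gamma> $ j" by (metis Suc_1 not_less_eq_eq)
    then obtain \<delta> where \<delta>: "\<gamma> = \<delta> + axis j 2" by (rule exponent_split_axis)
    have "monomial c \<gamma> = monomial c \<delta> * box_constraint a b j
        + monomial (c * (a $ j + b $ j)) (\<delta> + axis j 1) + monomial (- (c * (a $ j * b $ j))) \<delta>"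
      using monomial_diff[of 0 "c * (a $ j * b $ j)" \<delta>]
      by (simp add: \<delta> box_constraint_eq algebra_simps mult_monomial)
    moreover have "reducible a b D (monomial c \<delta> * box_constraint a b j)"
      using less.prems \<delta>
      by (intro reducible_mult_box_constraint total_degree_monomial_le) simp
    moreover have "reducible a b D (monomial (c * (a $ j + b $ j)) (\<delta> + axis j 1))"
      by (rule less.hyps) (use less.prems \<delta> in auto)
    moreover have "reducible a b D (monomial (- (c * (a $ j * b $ j))) \<delta>)"
      by (rule less.hyps) (use less.prems \<delta> in auto)
    ultimately show ?thesis by (simp only: reducible_add)
  qed
qed

lemma reducible_total_degree:
  assumes "total_degree f \<le> D + 2"
  shows "reducible a b D f"
proof -
  have "reducible a b D (\<Sum>\<gamma>\<in>A. monomial (Poly_Mapping.lookup f \<gamma>) \<gamma>)"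
    if "finite A" "\<forall>\<gamma>\<in>A. weight \<gamma> \<le> D + 2" for A
    using that
  proof (induction A rule: finite_induct)
    case empty
    then show ?case by (simp add: reducible_multilinear multilinear_def)
  next
    case (insert \<gamma> A)
    then show ?case by (simp add: reducible_add reducible_monomial)
  qed
  from this[of "Poly_Mapping.keys f"] show ?thesis
    using assms by (simp add: total_degree_le_iff flip: sum_monomials)
qed

text \<open>
  \<open>W e j t\<close> are the weights of the functionals \<open>h \<mapsto> (b h(a) - a h(b)) / (b - a)\<close> for \<open>e = 0\<close> and
  \<open>h \<mapsto> (h(b) - h(a)) / (b - a)\<close> for \<open>e = 1\<close>, which read off the coefficients of an affine \<open>h\<close>.
  Their tensor products read off those of a multilinear polynomial.
\<close>

lemma multilinear_vanishing:
  fixes r :: "'n::finite mpoly"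
  assumes ab: "\<forall>j. a $ j < b $ j"
    and r: "multilinear r"
    and van: "\<forall>x\<in>hypercube a b. eval r x = 0"
  shows "r = 0"
proof (rule poly_mapping_eqI)
  fix \<delta>
  define W where "W e j t =
    (if e = (0::nat) then if t = a $ j then b $ j else - (a $ j) else if t = a $ j then -1 else 1)
      / (b $ j - a $ j)" for e j t
  \<comment> \<open>The hypercube with its points as functions, the form in which a sum of products
    over the grid factors.\<close>
  let ?H = "PiE UNIV (\<lambda>j. {a $ j, b $ j})"
  have W: "(\<Sum>t\<in>{a $ j, b $ j}. W e j t * t ^ k) = (if k = e then 1 else 0)"
    if "e \<le> 1" "k \<le> 1" for e j k
  proof -
    have "a $ j \<noteq> b $ j" "b $ j - a $ j \<noteq> 0" using ab by (auto dest: spec[of _ j])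
    moreover have "e = 0 \<or> e = 1" "k = 0 \<or> k = 1" using that by auto
    ultimately show ?thesis
      by (auto simp: W_def minus_divide_left simp flip: add_divide_distrib diff_divide_distrib)
  qed
  show "Poly_Mapping.lookup r \<delta> = Poly_Mapping.lookup 0 \<delta>"
  \<comment> \<open>Inside the support, multilinearity bounds each \<open>\<delta> $ j\<close> by 1,
    so \<open>W (\<delta> $ j) j\<close> is one of the two functionals.\<close>
  proof (cases "\<delta> \<in> Poly_Mapping.keys r")
    case False
    then show ?thesis by (simp add: in_keys_iff)
  next
    case True
    \<comment> \<open>The sum over the grid factors into one sum per coordinate, each a Kronecker
      delta by \<open>W\<close>.\<close>
    have orth: "(\<Sum>y\<in>?H. (\<Prod>j\<in>UNIV. W (\<delta> $ j) j (y j)) * power_vec (\<chi> j. y j) \<gamma>) =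
        (if \<gamma> = \<delta> then 1 else 0)"
      if "\<gamma> \<in> Poly_Mapping.keys r" for \<gamma>
    proof -
      have "(\<Sum>y\<in>?H. (\<Prod>j\<in>UNIV. W (\<delta> $ j) j (y j)) * power_vec (\<chi> j. y j) \<gamma>) =
          (\<Sum>y\<in>?H. \<Prod>j\<in>UNIV. W (\<delta> $ j) j (y j) * y j ^ (\<gamma> $ j))"
        by (simp add: power_vec_def prod.distrib)
      also have "\<dots> = (\<Prod>j\<in>UNIV. \<Sum>t\<in>{a $ j, b $ j}. W (\<delta> $ j) j t * t ^ (\<gamma> $ j))"
        by (rule prod_sum_PiE[symmetric]) auto
      also have "\<dots> = (\<Prod>j\<in>UNIV. if \<gamma> $ j = \<delta> $ j then 1 else 0)"
        using r that True by (intro prod.cong W refl) (auto simp: multilinear_def)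
      also have "\<dots> = (if \<gamma> = \<delta> then 1 else 0)"
        by (auto simp: vec_eq_iff)
      finally show ?thesis .
    qed
    \<comment> \<open>The tensor functional for \<open>\<delta>\<close> only uses values of
      \<open>r\<close> on the grid, so it gives 0; expanded over the monomials of \<open>r\<close>,
      it gives the coefficient at \<open>\<delta>\<close>.\<close>
    have "0 = (\<Sum>y\<in>?H. (\<Prod>j\<in>UNIV. W (\<delta> $ j) j (y j)) * eval r (\<chi> j. y j))"
      using van by (intro sum.neutral[symmetric]) (auto simp: hypercube_def PiE_iff)
    also have "\<dots> = (\<Sum>\<gamma>\<in>Poly_Mapping.keys r. Poly_Mapping.lookup r \<gamma> *
        (\<Sum>y\<in>?H. (\<Prod>j\<in>UNIV. W (\<delta> $ j) j (y j)) * power_vec (\<chi> j. y j) \<gamma>))"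
      unfolding eval_superset[OF finite_keys subset_refl] sum_distrib_left
      by (subst sum.swap) (simp add: ac_simps)
    also have "\<dots> = (\<Sum>\<gamma>\<in>Poly_Mapping.keys r. Poly_Mapping.lookup r \<gamma> * (if \<gamma> = \<delta> then 1 else 0))"
      by (intro sum.cong) (simp_all add: orth)
    also have "\<dots> = Poly_Mapping.lookup r \<delta>"
      using True by (simp add: if_distrib cong: if_cong)
    finally show ?thesis by simp
  qed
qed

theorem theorem4p7:
  fixes a b :: "real ^ 'n::finite"
    and d :: nat
    and f :: "'n mpoly"
  assumes "\<forall>j. a $ j < b $ j"
    and "total_degree f \<le> 2 * d + 2"
    and "\<forall>x\<in>hypercube a b. eval f x = 0"
  shows "\<exists>s t :: 'n \<Rightarrow> 'n mpoly.
           (\<forall>j. s j \<in> SONC (2 * d)) \<and> (\<forall>j. t j \<in> SONC (2 * d)) \<and>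
           f = (\<Sum>j\<in>UNIV. s j * box_constraint a b j) + (\<Sum>j\<in>UNIV. t j * (- box_constraint a b j))"
proof -
  obtain p r where p: "\<forall>j. total_degree (p j) \<le> 2 * d" and r: "multilinear r"
    and f: "f = (\<Sum>j\<in>UNIV. p j * box_constraint a b j) + r"
    using reducible_total_degree[OF assms(2)] unfolding reducible_def by blast
  \<comment> \<open>Every multiple of a box constraint vanishes on the grid, so \<open>r\<close>
    inherits the zeros of \<open>f\<close>.\<close>
  have "eval r x = 0" if "x \<in> hypercube a b" for x
  proof -
    have "eval (box_constraint a b j) x = 0" for j
      using that by (auto simp: eval_box_constraint hypercube_def dest: spec[of _ j])
    then have "eval f x = eval r x" by (simp add: f eval_sum)
    with assms(3) that show ?thesis by simp
  qed
  then have "r = 0" using multilinear_vanishing[OF assms(1) r] by blast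
  moreover have "\<forall>j. \<exists>s t. s \<in> SONC (2 * d) \<and> t \<in> SONC (2 * d) \<and> p j = s - t"
    using SONC_difference p by blast
  then obtain s t where "\<forall>j. s j \<in> SONC (2 * d) \<and> t j \<in> SONC (2 * d) \<and> p j = s j - t j"
    by metis
  \<comment> \<open>With \<open>r = 0\<close> and \<open>p j = s j - t j\<close>, the negative part
    is absorbed by the constraint \<open>- box_constraint a b j\<close>.\<close>
  ultimately show ?thesis
    by (intro exI[of _ s] exI[of _ t])
       (auto simp: f left_diff_distrib sum_subtractf sum_negf)
qed

end
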